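(* No mechanism simultaneously satisfies ex-post favoring-higher-ranks (ep-FHR), sd-weak-envy-freeness (sd-WEF), and strong equal treatment of equals (SETE).
   Context: Setting. An assignment problem has a set $N=\{1,\dots,n\}$ of agents and a set $M$ of $n$ items (one unit each). A preference profile $R=(\succ_j)_{j\in N}$ gives each agent $j$ a strict linear order $\succ_j$ on $M$. $rk(j,o)\in\{1,\dots,n\}$ is the rank of $o$ in $\succ_j$ ($1$ = best); for nonempty $S\subseteq M$, $\mathrm{top}(j,S)$ is the $\succ_j$-best item of $S$. A random assignment is a doubly stochastic $n\times n$ matrix $P=[p_{j,o}]$ with rows $P_j$. A deterministic assignment is a bijection $A:N\to M$, identified with its permutation matrix. A mechanism assigns to every preference profile (of every assignment problem, of any size $n$) a random assignment; it satisfies a property of random assignments if its output satisfies it for every profile. FHR: a deterministic assignment $A$ satisfies FHR if for all $j,k\in N$, $rk(j,A(j))\le rk(k,A(j))$ or $rk(k,A(k))<rk(k,A(j))$. A random assignment satisfies ep-FHR if it is a convex combination of deterministic assignments satisfying FHR. Stochastic dominance. $U(\succ,o)=\{o'\in M:o'\succ o\}\cup\{o\}$. For probability vectors $p,q$ on $M$, $p\succeq^{sd}_jq$ means $\sum_{o'\in U(\succ_j,o)}p_{o'}\ge\sum_{o'\in U(\succ_j,o)}q_{o'}$ for all $o\in M$. sd-WEF: $P$ is sd-WEF if for all $j,k\in N$, $P_k\succeq^{sd}_jP_j$ implies $P_j=P_k$. SETE: for agents $j,k$, their common prefix is the set $M'\subseteq M$ such that $rk(j,o)=rk(k,o)\le|M'|$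 for all $o\in M'$ and $\mathrm{top}(j,M\setminus M')\neq\mathrm{top}(k,M\setminus M')$ (with $M'=M$ if $\succ_j=\succ_k$). $P$ satisfies SETE if $p_{j,o}=p_{k,o}$ for all $j,k\in N$ and all $o$ in the common prefix of $j$ and $k$. *)

theory Defs
  imports Complex_Main "HOL-Library.FuncSet"
begin

text \<open>Agents are the numbers \<open>{1..n}\<close>; items are the elements of a set of size \<open>n\<close> in an arbitrary
  type. In a preference relation \<open>r\<close>, \<open>(x, y) \<in> r\<close> means that \<open>x\<close> is strictly better than \<open>y\<close>.\<close>

type_synonym 'i profile = "nat \<Rightarrow> 'i rel"
type_synonym 'i matrix = "nat \<Rightarrow> 'i \<Rightarrow> real"
type_synonym 'i mechanism = "nat \<Rightarrow> 'i set \<Rightarrow> 'i profile \<Rightarrow> 'i matrix"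

definition assignment_problem :: "nat \<Rightarrow> 'i set \<Rightarrow> bool" where
  "assignment_problem n M \<longleftrightarrow> 1 \<le> n \<and> finite M \<and> card M = n"

definition preferences :: "'i set \<Rightarrow> 'i rel set" where
  "preferences M = {r. r \<subseteq> M \<times> M \<and> strict_linear_order_on M r}"

definition profiles :: "nat \<Rightarrow> 'i set \<Rightarrow> 'i profile set" where
  "profiles n M = {1..n} \<rightarrow>\<^sub>E preferences M"

definition rk :: "'i set \<Rightarrow> 'i rel \<Rightarrow> 'i \<Rightarrow> nat" where
  "rk M r x = card {y \<in> M. (y, x) \<in> r} + 1"

text \<open>Only meaningful for nonempty \<open>S\<close>.\<close>

definition top_item :: "'i rel \<Rightarrow> 'i set \<Rightarrow> 'i" where
  "top_item r S = (THE x. x \<in> S \<and> (\<forall>y \<in> S - {x}. (x, y) \<in> r))"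

definition random_assignment :: "nat \<Rightarrow> 'i set \<Rightarrow> 'i matrix \<Rightarrow> bool" where
  "random_assignment n M P \<longleftrightarrow>
     (\<forall>j\<in>{1..n}. \<forall>x\<in>M. 0 \<le> P j x) \<and>
     (\<forall>j\<in>{1..n}. (\<Sum>x\<in>M. P j x) = 1) \<and>
     (\<forall>x\<in>M. (\<Sum>j\<in>{1..n}. P j x) = 1)"

definition deterministic_assignment :: "nat \<Rightarrow> 'i set \<Rightarrow> (nat \<Rightarrow> 'i) \<Rightarrow> bool" where
  "deterministic_assignment n M A \<longleftrightarrow> bij_betw A {1..n} M"

definition permutation_matrix :: "(nat \<Rightarrow> 'i) \<Rightarrow> 'i matrix" where
  "permutation_matrix A = (\<lambda>j x. if A j = x then 1 else 0)"

definition FHR :: "nat \<Rightarrow> 'i set \<Rightarrow> 'i profile \<Rightarrow> (nat \<Rightarrow> 'i) \<Rightarrow> bool" where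
  "FHR n M R A \<longleftrightarrow>
     (\<forall>j\<in>{1..n}. \<forall>k\<in>{1..n}.
        rk M (R j) (A j) \<le> rk M (R k) (A j) \<or> rk M (R k) (A k) < rk M (R k) (A j))"

definition ep_FHR :: "nat \<Rightarrow> 'i set \<Rightarrow> 'i profile \<Rightarrow> 'i matrix \<Rightarrow> bool" where
  "ep_FHR n M R P \<longleftrightarrow>
     (\<exists>D w. finite D \<and> (\<forall>A\<in>D. deterministic_assignment n M A \<and> FHR n M R A) \<and>
        (\<forall>A\<in>D. (0::real) \<le> w A) \<and> (\<Sum>A\<in>D. w A) = 1 \<and>
        (\<forall>j\<in>{1..n}. \<forall>x\<in>M. P j x = (\<Sum>A\<in>D. w A * permutation_matrix A j x)))"

definition upper_contour :: "'i set \<Rightarrow> 'i rel \<Rightarrow> 'i \<Rightarrow> 'i set" where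
  "upper_contour M r x = {y \<in> M. (y, x) \<in> r} \<union> {x}"

definition sd_dominates :: "'i set \<Rightarrow> 'i rel \<Rightarrow> ('i \<Rightarrow> real) \<Rightarrow> ('i \<Rightarrow> real) \<Rightarrow> bool" where
  "sd_dominates M r p q \<longleftrightarrow>
     (\<forall>x\<in>M. (\<Sum>y\<in>upper_contour M r x. p y) \<ge> (\<Sum>y\<in>upper_contour M r x. q y))"

definition sd_WEF :: "nat \<Rightarrow> 'i set \<Rightarrow> 'i profile \<Rightarrow> 'i matrix \<Rightarrow> bool" where
  "sd_WEF n M R P \<longleftrightarrow>
     (\<forall>j\<in>{1..n}. \<forall>k\<in>{1..n}.
        sd_dominates M (R j) (P k) (P j) \<longrightarrow> (\<forall>x\<in>M. P j x = P k x))"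

text \<open>For distinct preferences the prefix is a proper subset of \<open>M\<close>, since equal ranks on all of \<open>M\<close>
  would make them equal; requiring this keeps \<open>top_item\<close> away from the empty set. The set \<open>C\<close> is
  uniquely determined by \<open>M\<close>, \<open>r\<close> and \<open>s\<close>: the rank condition makes \<open>C\<close> consist of the \<open>card C\<close>
  best items of both relations, and the last condition makes it maximal.\<close>

definition is_common_prefix :: "'i set \<Rightarrow> 'i rel \<Rightarrow> 'i rel \<Rightarrow> 'i set \<Rightarrow> bool" where
  "is_common_prefix M r s C \<longleftrightarrow>
     (if r = s then C = M
      else C \<subset> M \<and> (\<forall>x\<in>C. rk M r x = rk M s x \<and> rk M s x \<le> card C) \<and>
           top_item r (M - C) \<noteq> top_item s (M - C))"

definition SETE :: "nat \<Rightarrow> 'i set \<Rightarrow> 'i profile \<Rightarrow> 'i matrix \<Rightarrow> bool" where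
  "SETE n M R P \<longleftrightarrow>
     (\<forall>j\<in>{1..n}. \<forall>k\<in>{1..n}. \<forall>C. is_common_prefix M (R j) (R k) C \<longrightarrow> (\<forall>x\<in>C. P j x = P k x))"

definition mechanism :: "'i mechanism \<Rightarrow> bool" where
  "mechanism f \<longleftrightarrow>
     (\<forall>n M R. assignment_problem n M \<and> R \<in> profiles n M \<longrightarrow> random_assignment n M (f n M R))"

definition mechanism_satisfies ::
    "'i mechanism \<Rightarrow> (nat \<Rightarrow> 'i set \<Rightarrow> 'i profile \<Rightarrow> 'i matrix \<Rightarrow> bool) \<Rightarrow> bool" where
  "mechanism_satisfies f Q \<longleftrightarrow>
     (\<forall>n M R. assignment_problem n M \<and> R \<in> profiles n M \<longrightarrow> Q n M R (f n M R))"

end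

theory Submission
  imports Defs
begin

text \<open>Consider agents with the preferences \<open>a b c d\<close>, \<open>a c b d\<close>, \<open>a c b d\<close> and \<open>b a c d\<close>. Under
  FHR agent 4 gets \<open>b\<close>, and agent 1 never gets \<open>c\<close>: both 2 and 3 rank \<open>c\<close> higher and cannot both
  be compensated with \<open>a\<close>. By SETE agents 1 and 2 get \<open>a\<close> with the same probability, so agent 1
  finds the lottery of agent 2 at least as good as its own. Then sd-WEF makes the two lotteries
  equal, and so neither agent 2 nor, by SETE, agent 3 ever gets \<open>c\<close>. Nobody is left to get \<open>c\<close>.\<close>

definition chain4 :: "'i \<Rightarrow> 'i \<Rightarrow> 'i \<Rightarrow> 'i \<Rightarrow> 'i rel" where
  "chain4 p q r s = {(p, q), (p, r), (p, s), (q, r), (q, s), (r, s)}"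

lemma chain4_preferences:
  assumes "distinct [p, q, r, s]"
  shows "chain4 p q r s \<in> preferences {p, q, r, s}"
  using assms
  by (auto simp: preferences_def chain4_def strict_linear_order_on_def trans_def irrefl_def
      total_on_def)

lemma rk_chain4:
  assumes "distinct [p, q, r, s]" "M = {p, q, r, s}"
  shows "rk M (chain4 p q r s) p = 1"
    and "rk M (chain4 p q r s) q = 2"
    and "rk M (chain4 p q r s) r = 3"
    and "rk M (chain4 p q r s) s = 4"
proof -
  have better: "{y \<in> M. (y, p) \<in> chain4 p q r s} = {}" "{y \<in> M. (y, q) \<in> chain4 p q r s} = {p}"
    "{y \<in> M. (y, r) \<in> chain4 p q r s} = {p, q}" "{y \<in> M. (y, s) \<in> chain4 p q r s} = {p, q, r}"
    using assms by (auto simp: chain4_def)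
  show "rk M (chain4 p q r s) p = 1" "rk M (chain4 p q r s) q = 2"
    "rk M (chain4 p q r s) r = 3" "rk M (chain4 p q r s) s = 4"
    using assms(1) by (simp_all add: rk_def better)
qed

lemma upper_contour_chain4:
  assumes "distinct [p, q, r, s]" "M = {p, q, r, s}"
  shows "upper_contour M (chain4 p q r s) p = {p}"
    and "upper_contour M (chain4 p q r s) q = {p, q}"
    and "upper_contour M (chain4 p q r s) r = {p, q, r}"
    and "upper_contour M (chain4 p q r s) s = M"
  using assms by (auto simp: chain4_def upper_contour_def)

text \<open>Meant for two agents who share the best item \<open>p\<close>: once it is removed, their
  next items decide whether \<open>{p}\<close> is their whole common prefix.\<close>

lemma top_item_chain4_tail:
  assumes "distinct [p, q, r, s]" "S = {q, r, s}"
  shows "top_item (chain4 p q r s) S = q"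
  unfolding top_item_def by (rule the_equality) (use assms in \<open>auto simp: chain4_def\<close>)

text \<open>Every term of the convex combination vanishes at this entry, so an exclusion proved for
  all FHR assignments carries over to the lottery.\<close>

lemma ep_FHR_eq_0:
  assumes "ep_FHR n M R P" "j \<in> {1..n}" "x \<in> M"
    and "\<And>A. deterministic_assignment n M A \<Longrightarrow> FHR n M R A \<Longrightarrow> A j \<noteq> x"
  shows "P j x = 0"
proof -
  obtain D w where
    "\<forall>A\<in>D. deterministic_assignment n M A \<and> FHR n M R A"
    "\<forall>j\<in>{1..n}. \<forall>x\<in>M. P j x = (\<Sum>A\<in>D. w A * permutation_matrix A j x)"
    using assms(1) unfolding ep_FHR_def by blast
  then show ?thesis
    using assms(2-4) by (auto simp: permutation_matrix_def intro!: sum.neutral)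
qed

text \<open>The restriction to \<open>{1..4}\<close> makes the function extensional, as membership
  in \<open>profiles\<close> demands.\<close>

definition conflict_profile :: "'i \<Rightarrow> 'i \<Rightarrow> 'i \<Rightarrow> 'i \<Rightarrow> 'i profile" where
  "conflict_profile a b c d = (\<lambda>j\<in>{1..4}.
     if j = 1 then chain4 a b c d else if j = 4 then chain4 b a c d else chain4 a c b d)"

text \<open>Agent 1 is written \<open>Suc 0\<close> because the simplifier rewrites
  \<open>1::nat\<close> to this form.\<close>

lemma conflict_profile_simps [simp]:
  "conflict_profile a b c d (Suc 0) = chain4 a b c d"
  "conflict_profile a b c d 2 = chain4 a c b d"
  "conflict_profile a b c d 3 = chain4 a c b d"
  "conflict_profile a b c d 4 = chain4 b a c d"
  by (simp_all add: conflict_profile_def)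

lemma atLeastAtMost_1_4: "{1..4::nat} = {1, 2, 3, 4}"
  by auto

context
  fixes a b c d :: 'i and M :: "'i set"
  assumes distinct: "distinct [a, b, c, d]" and M: "M = {a, b, c, d}"
begin

lemma conflict_profile_in_profiles: "conflict_profile a b c d \<in> profiles 4 M"
proof -
  have "chain4 a b c d \<in> preferences M" "chain4 a c b d \<in> preferences M"
    "chain4 b a c d \<in> preferences M"
    using chain4_preferences[of a b c d] chain4_preferences[of a c b d]
      chain4_preferences[of b a c d] distinct by (auto simp: M insert_commute)
  then show ?thesis
    by (auto simp: profiles_def conflict_profile_def)
qed

lemma rk_conflict_chains:
  "rk M (chain4 a b c d) b = 2" "rk M (chain4 a b c d) c = 3"
  "rk M (chain4 a c b d) a = 1" "rk M (chain4 a c b d) b = 3" "rk M (chain4 a c b d) c = 2"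
  "rk M (chain4 a c b d) d = 4" "rk M (chain4 a b c d) a = 1"
  "rk M (chain4 b a c d) b = 1"
proof -
  have acbd: "distinct [a, c, b, d]" "M = {a, c, b, d}"
    and bacd: "distinct [b, a, c, d]" "M = {b, a, c, d}"
    using distinct M by auto
  show "rk M (chain4 a b c d) b = 2" "rk M (chain4 a b c d) c = 3"
    "rk M (chain4 a c b d) a = 1" "rk M (chain4 a c b d) b = 3" "rk M (chain4 a c b d) c = 2"
    "rk M (chain4 a c b d) d = 4" "rk M (chain4 a b c d) a = 1"
    "rk M (chain4 b a c d) b = 1"
    by (simp_all add: rk_chain4[OF distinct M] rk_chain4[OF acbd] rk_chain4[OF bacd])
qed

context
  fixes A
  assumes det: "deterministic_assignment 4 M A" and FHR: "FHR 4 M (conflict_profile a b c d) A"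
begin

text \<open>The last premise refutes the first disjunct of FHR, so \<open>k\<close> must be
  compensated with something better than \<open>x\<close>.\<close>

lemma FHR_conflictD:
  assumes "j \<in> {1, 2, 3, 4}" "k \<in> {1, 2, 3, 4}" "A j = x"
    and "rk M (conflict_profile a b c d k) x < rk M (conflict_profile a b c d j) x"
  shows "rk M (conflict_profile a b c d k) (A k) < rk M (conflict_profile a b c d k) x"
  using FHR assms unfolding FHR_def atLeastAtMost_1_4 by (metis not_le)

lemma A_in_M: "j \<in> {1, 2, 3, 4} \<Longrightarrow> A j \<in> M"
  using det unfolding deterministic_assignment_def atLeastAtMost_1_4 by (rule bij_betw_apply)

text \<open>Agent 4 ranks \<open>b\<close> first and the others do not, and nothing better than a
  first choice exists as compensation.\<close>

lemma b_not_assigned: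
  assumes "j \<in> {1, 2, 3}"
  shows "A j \<noteq> b"
proof
  assume "A j = b"
  then have "rk M (conflict_profile a b c d 4) (A 4) < rk M (conflict_profile a b c d 4) b"
    by (rule FHR_conflictD[rotated 2]) (use assms in \<open>auto simp: rk_conflict_chains\<close>)
  then show False
    \<comment> \<open>Ranks start at 1, so no item has rank below that of \<open>b\<close> for agent
      4.\<close>
    by (simp add: rk_conflict_chains rk_def[of _ _ "A 4"])
qed

lemma c_not_assigned: "A 1 \<noteq> c" "A 4 \<noteq> c"
proof
  assume c: "A 1 = c"
  \<comment> \<open>Agents 2 and 3 rank \<open>c\<close> second, so \<open>a\<close> is the only
    possible compensation for either.\<close>
  have "A k = a" if "k \<in> {2, 3}" for k
  proof -
    have "rk M (conflict_profile a b c d k) (A k) < rk M (conflict_profile a b c d k) c"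
      using c by (rule FHR_conflictD[rotated 2]) (use that in \<open>auto simp: rk_conflict_chains\<close>)
    then have "rk M (chain4 a c b d) (A k) < 2"
      using that by (elim insertE) (simp_all add: rk_conflict_chains)
    moreover have "A k = a \<or> A k = b \<or> A k = c \<or> A k = d"
      using A_in_M[of k] that by (auto simp: M)
    ultimately show ?thesis
      by (elim disjE) (simp_all add: rk_conflict_chains)
  qed
  then have "A 2 = A 3"
    by simp
  then show False
    using det by (auto simp: deterministic_assignment_def bij_betw_def dest: inj_onD[of _ _ 2 3])
next
  \<comment> \<open>Surjectivity hands \<open>b\<close> to someone, and only agent 4
    remains.\<close>
  have "b \<in> A ` {1, 2, 3, 4}"
    using det unfolding deterministic_assignment_def atLeastAtMost_1_4 bij_betw_def by (simp add: M)
  then have "A 4 = b"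
    using b_not_assigned by blast
  then show "A 4 \<noteq> c"
    using distinct by auto
qed

end

lemma conflict_profile_incompatible:
  assumes "random_assignment 4 M P"
    and "ep_FHR 4 M (conflict_profile a b c d) P"
    and "sd_WEF 4 M (conflict_profile a b c d) P"
    and "SETE 4 M (conflict_profile a b c d) P"
  shows False
proof -
  let ?R = "conflict_profile a b c d"
  have zero: "P 1 b = 0" "P 2 b = 0" "P 1 c = 0" "P 4 c = 0"
    using ep_FHR_eq_0[OF assms(2)] b_not_assigned c_not_assigned by (simp_all add: M)
  have row: "(\<Sum>x\<in>M. P j x) = 1" if "j \<in> {1..4}" for j
    using assms(1) that by (simp add: random_assignment_def)
  have nonneg: "0 \<le> P 2 c"
    using assms(1) by (simp add: random_assignment_def M)
  have tail: "M - {a} = {b, c, d}" "M - {a} = {c, b, d}"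
    using distinct by (auto simp: M)
  have top: "top_item (?R 1) (M - {a}) = b" "top_item (?R 2) (M - {a}) = c"
    using top_item_chain4_tail[OF _ tail(1)] top_item_chain4_tail[OF _ tail(2)] distinct by auto
  \<comment> \<open>Different tops after \<open>a\<close> separate the relations, which selects the
    second branch of \<open>is_common_prefix\<close>.\<close>
  then have "?R 1 \<noteq> ?R 2"
    using distinct by force
  moreover have "{a} \<subset> M"
    using distinct by (auto simp: M)
  ultimately have "is_common_prefix M (?R 1) (?R 2) {a}"
    using distinct top by (simp add: is_common_prefix_def rk_conflict_chains)
  then have a: "P 1 a = P 2 a"
    using assms(4) by (auto simp: SETE_def)
  have "sd_dominates M (?R 1) (P 2) (P 1)"
    unfolding sd_dominates_def
  proof
    fix x assume "x \<in> M"
    then consider "x = a" | "x = b" | "x = c" | "x = d"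
      by (auto simp: M)
    \<comment> \<open>The sums agree at \<open>a\<close> by SETE, at \<open>b\<close> since neither
      agent gets \<open>b\<close>, and at \<open>d\<close> since rows sum to 1. At \<open>c\<close>
      agent 2 gains \<open>P 2 c\<close>, while \<open>P 1 c\<close> is 0.\<close>
    then show "sum (P 1) (upper_contour M (?R 1) x) \<le> sum (P 2) (upper_contour M (?R 1) x)"
      by cases (use distinct zero a nonneg row[of 1] row[of 2] in
          \<open>simp_all add: upper_contour_chain4[OF distinct M]\<close>)
  qed
  moreover have "c \<in> M"
    by (simp add: M)
  ultimately have "P 1 c = P 2 c"
    using assms(3) unfolding sd_WEF_def atLeastAtMost_1_4 by blast
  then have "P 2 c = 0"
    using zero by simp
  \<comment> \<open>Agents 2 and 3 have the same preferences, so their common prefix is all of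
    \<open>M\<close>.\<close>
  moreover have "P 3 c = P 2 c"
    using assms(4) by (auto simp: SETE_def is_common_prefix_def M)
  moreover have "(\<Sum>j\<in>{1, 2, 3, 4}. P j c) = 1"
    using assms(1) \<open>c \<in> M\<close> unfolding random_assignment_def atLeastAtMost_1_4 by blast
  ultimately show False
    using zero by simp
qed

end

theorem proposition1:
  assumes "infinite (UNIV :: 'i set)"
  shows "\<not> (\<exists>f :: 'i mechanism. mechanism f \<and> mechanism_satisfies f ep_FHR \<and>
                mechanism_satisfies f sd_WEF \<and> mechanism_satisfies f SETE)"
proof
  assume "\<exists>f :: 'i mechanism. mechanism f \<and> mechanism_satisfies f ep_FHR \<and>
                mechanism_satisfies f sd_WEF \<and> mechanism_satisfies f SETE"
  then obtain f :: "'i mechanism" where f: "mechanism f" "mechanism_satisfies f ep_FHR"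
    "mechanism_satisfies f sd_WEF" "mechanism_satisfies f SETE"
    by blast
  \<comment> \<open>The infinite item type supplies the four items of the counterexample.\<close>
  obtain M :: "'i set" where "finite M" "card M = 4"
    using infinite_arbitrarily_large[OF assms] by blast
  then obtain xs where xs: "set xs = M" "distinct xs" "length xs = 4"
    by (metis finite_distinct_list distinct_card)
  then obtain a b c d where "xs = [a, b, c, d]"
    by (auto simp: numeral_eq_Suc length_Suc_conv)
  with xs have M: "distinct [a, b, c, d]" "M = {a, b, c, d}"
    by auto
  have "assignment_problem 4 M"
    using \<open>finite M\<close> \<open>card M = 4\<close> by (simp add: assignment_problem_def)
  with f conflict_profile_in_profiles[OF M] show False
    by (intro conflict_profile_incompatible[OF M, of "f 4 M (conflict_profile a b c d)"])
      (simp_all add: mechanism_def mechanism_satisfies_def)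
qed

end
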